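(* Let $n\in\mathbb{N}$. The maximum of $c_a$ over $a\in\mathcal{A}_n$ is attained at some element of $$\mathcal{M}_n=\{(a_1,\ldots,a_n)\in\mathcal{A}_n : a_{i+1}\le a_i\le a_{i+1}+1 \text{ for all } 1\le i\le n-1\}.$$
   Context: For $n\in\mathbb{N}$ and indeterminates $x_1,\ldots,x_n$, let $p_n=x_1(x_1+x_2)\cdots(x_1+x_2+\cdots+x_n)$. Let $\mathbb{N}_0=\mathbb{N}\cup\{0\}$ and $\mathcal{A}_n=\{(a_1,\ldots,a_n)\in\mathbb{N}_0^n : \sum_{i=k+1}^n a_i\le n-k \text{ for all } 1\le k\le n-1,\ \sum_{i=1}^n a_i=n\}$; these are exactly the exponent vectors of the monomials of $p_n$. For $a\in\mathcal{A}_n$, $c_a$ denotes the coefficient of $x_1^{a_1}\cdots x_n^{a_n}$ in the expansion of $p_n$. *)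

theory Defs
  imports Complex_Main "HOL-Library.Poly_Mapping"
begin

text \<open>
  Multivariate polynomials over the integers in indeterminates indexed by natural numbers are
  finitely supported maps from monomials to coefficients. A monomial is given by its exponent
  vector, itself a finitely supported map from indices to exponents. The multiplication that
  Poly_Mapping provides is convolution, i.e. polynomial multiplication.
\<close>

type_synonym exponents = "nat \<Rightarrow>\<^sub>0 nat"
type_synonym int_mpoly = "exponents \<Rightarrow>\<^sub>0 int"

definition indet :: "nat \<Rightarrow> int_mpoly" where
  "indet i = Poly_Mapping.single (Poly_Mapping.single i 1) 1"

definition p_poly :: "nat \<Rightarrow> int_mpoly" where
  "p_poly n = (\<Prod>k = 1..n. \<Sum>i = 1..k. indet i)"

definition c_coeff :: "nat \<Rightarrow> exponents \<Rightarrow> int" where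
  "c_coeff n a = Poly_Mapping.lookup (p_poly n) a"

text \<open>
  A vector of length n is an exponent vector whose support lies in \<open>{1..n}\<close>;
  its entries are numbered from 1.
\<close>

definition A_set :: "nat \<Rightarrow> exponents set" where
  "A_set n = {a. Poly_Mapping.keys a \<subseteq> {1..n} \<and>
             (\<forall>k. 1 \<le> k \<and> k \<le> n - 1 \<longrightarrow> (\<Sum>i = k+1..n. Poly_Mapping.lookup a i) \<le> n - k) \<and>
             (\<Sum>i = 1..n. Poly_Mapping.lookup a i) = n}"

definition M_set :: "nat \<Rightarrow> exponents set" where
  "M_set n = {a \<in> A_set n. \<forall>i. 1 \<le> i \<and> i \<le> n - 1 \<longrightarrow>
             Poly_Mapping.lookup a (i+1) \<le> Poly_Mapping.lookup a i \<and>
             Poly_Mapping.lookup a i \<le> Poly_Mapping.lookup a (i+1) + 1}"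

end

theory Submission
  imports Defs
begin

text \<open>
  Extracting the powers of \<open>x\<^sub>n, x\<^sub>n\<^sub>-\<^sub>1, \<dots>\<close> successively yields
  \<open>c\<^sub>a \<cdot> \<Prod>\<^sub>i a\<^sub>i! = \<Prod>\<^sub>i (n + 1 - i - \<Sum>\<^sub>k\<^sub>>\<^sub>i a\<^sub>k)\<close>. Redistributing
  \<open>a\<^sub>i + a\<^sub>i\<^sub>+\<^sub>1\<close> between the two neighbouring entries changes a single factor on the right.
  Hence swapping neighbours with \<open>a\<^sub>i < a\<^sub>i\<^sub>+\<^sub>1\<close> strictly increases the coefficient, and moving
  one unit from \<open>a\<^sub>i\<close> to \<open>a\<^sub>i\<^sub>+\<^sub>1\<close> when \<open>a\<^sub>i \<ge> a\<^sub>i\<^sub>+\<^sub>1 + 2\<close> does not decrease it while it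
  decreases \<open>\<Sum>\<^sub>i a\<^sub>i\<^sup>2\<close>. So a maximiser with least sum of squares lies in \<open>M\<^sub>n\<close>.
\<close>

section \<open>Extracting coefficients of polynomials\<close>

lemma lookup_single_mult:
  fixes m a :: exponents and g :: int_mpoly
  shows "Poly_Mapping.lookup (Poly_Mapping.single m 1 * g) a =
    (\<Sum>q. Poly_Mapping.lookup g q when a = m + q)"
proof -
  have "Poly_Mapping.lookup (Poly_Mapping.single m 1) l * c = (c when l = m)" for l and c :: int
    by (simp add: lookup_single when_def)
  then show ?thesis
    by (simp only: lookup_mult Sum_any_when_equal)
qed

lemma lookup_single_mult_plus:
  fixes m q :: exponents and g :: int_mpoly
  shows "Poly_Mapping.lookup (Poly_Mapping.single m 1 * g) (m + q) = Poly_Mapping.lookup g q"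
  by (simp add: lookup_single_mult)

lemma lookup_single_mult_eq_0:
  fixes m a :: exponents and g :: int_mpoly
  assumes "\<And>q. a = m + q \<Longrightarrow> Poly_Mapping.lookup g q = 0"
  shows "Poly_Mapping.lookup (Poly_Mapping.single m 1 * g) a = 0"
proof -
  have "(Poly_Mapping.lookup g q when a = m + q) = 0" for q
    using assms by (cases "a = m + q") auto
  then show ?thesis
    by (simp add: lookup_single_mult)
qed

lemma lookup_of_nat_mult:
  fixes g :: int_mpoly
  shows "Poly_Mapping.lookup (of_nat k * g) a = int k * Poly_Mapping.lookup g a"
  by (induction k) (simp_all add: lookup_add distrib_right)

lemma indet_power: "indet i ^ t = Poly_Mapping.single (Poly_Mapping.single i t) 1"
  by (induction t) (simp_all add: indet_def mult_single flip: single_add)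

text \<open>Phrased through the support, so that closure under sums and products follows from
  \<open>keys_sum\<close> and \<open>keys_mult\<close>.\<close>

definition free_of :: "nat \<Rightarrow> int_mpoly \<Rightarrow> bool" where
  "free_of i q \<longleftrightarrow> (\<forall>m\<in>Poly_Mapping.keys q. Poly_Mapping.lookup m i = 0)"

lemma free_of_mult: "free_of i p \<Longrightarrow> free_of i q \<Longrightarrow> free_of i (p * q)"
  using keys_mult[of p q] by (fastforce simp: free_of_def lookup_add)

lemma free_of_one: "free_of i 1"
  by (simp add: free_of_def)

lemma free_of_power: "free_of i p \<Longrightarrow> free_of i (p ^ k)"
  by (induction k) (auto intro: free_of_mult free_of_one)

lemma free_of_prod: "(\<And>k. k \<in> I \<Longrightarrow> free_of i (f k)) \<Longrightarrow> free_of i (prod f I)"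
  by (induction I rule: infinite_finite_induct) (auto intro: free_of_mult free_of_one)

lemma free_of_sum: "(\<And>k. k \<in> I \<Longrightarrow> free_of i (f k)) \<Longrightarrow> free_of i (sum f I)"
  using keys_sum[of f I] by (fastforce simp: free_of_def)

lemma free_of_indet: "j \<noteq> i \<Longrightarrow> free_of i (indet j)"
  by (simp add: free_of_def indet_def lookup_single)

text \<open>Every monomial of \<open>q\<close> has exponent 0 at \<open>j\<close>, so in the product
  that exponent is exactly \<open>t\<close>, and resetting it to 0 recovers the monomial of
  \<open>q\<close>.\<close>

lemma lookup_indet_power_mult:
  assumes "free_of j q"
  shows "Poly_Mapping.lookup (indet j ^ t * q) a =
    (if Poly_Mapping.lookup a j = t
     then Poly_Mapping.lookup q (Poly_Mapping.update j 0 a) else 0)"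
proof (cases "Poly_Mapping.lookup a j = t")
  case True
  then have "a = Poly_Mapping.single j t + Poly_Mapping.update j 0 a"
    by (intro poly_mapping_eqI) (auto simp: lookup_add lookup_single lookup_update)
  then show ?thesis
    using True lookup_single_mult_plus[of "Poly_Mapping.single j t" q "Poly_Mapping.update j 0 a"]
    by (simp add: indet_power)
next
  case False
  have "Poly_Mapping.lookup (Poly_Mapping.single (Poly_Mapping.single j t) 1 * q) a = 0"
  proof (rule lookup_single_mult_eq_0)
    fix b assume "a = Poly_Mapping.single j t + b"
    with False have "Poly_Mapping.lookup b j \<noteq> 0"
      by (auto simp: lookup_add)
    with assms show "Poly_Mapping.lookup q b = 0"
      by (metis free_of_def in_keys_iff)
  qed
  with False show ?thesis
    by (simp add: indet_power)
qed

text \<open>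
  The extra factor \<open>(x\<^sub>1 + \<dots> + x\<^sub>j)\<^sup>u\<close> makes the induction work: extracting the power of
  \<open>x\<^sub>j\<close> from \<open>p\<^sub>j (x\<^sub>1 + \<dots> + x\<^sub>j)\<^sup>u\<close> leaves a multiple of
  \<open>p\<^sub>j\<^sub>-\<^sub>1 (x\<^sub>1 + \<dots> + x\<^sub>j\<^sub>-\<^sub>1)\<^sup>v\<close> with \<open>v = u + 1 - a\<^sub>j\<close>.
\<close>

lemma lookup_p_poly_mult_Suc:
  fixes u :: nat
  defines "L \<equiv> \<lambda>j. \<Sum>i = 1..j. indet i"
  assumes le: "Poly_Mapping.lookup a (Suc j) \<le> Suc u"
  shows "Poly_Mapping.lookup (p_poly (Suc j) * L (Suc j) ^ u) a =
    int (Suc u choose Poly_Mapping.lookup a (Suc j)) *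
    Poly_Mapping.lookup (p_poly j * L j ^ (Suc u - Poly_Mapping.lookup a (Suc j)))
      (Poly_Mapping.update (Suc j) 0 a)"
proof -
  let ?t = "Poly_Mapping.lookup a (Suc j)" and ?N = "Suc u"
  have free: "free_of (Suc j) (p_poly j * L j ^ k)" for k
    unfolding p_poly_def L_def
    by (intro free_of_mult free_of_power free_of_prod free_of_sum free_of_indet) auto
  \<comment> \<open>The last factor of \<open>p_poly (Suc j)\<close> joins the power, and
    \<open>L (Suc j)\<close> splits as \<open>indet (Suc j) + L j\<close>, ready for the binomial
    theorem.\<close>
  have "p_poly (Suc j) * L (Suc j) ^ u = p_poly j * (indet (Suc j) + L j) ^ ?N"
    by (simp add: p_poly_def L_def algebra_simps)
  also have "\<dots> = (\<Sum>s\<le>?N. of_nat (?N choose s) *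
      (indet (Suc j) ^ s * (p_poly j * L j ^ (?N - s))))"
    by (simp only: binomial_ring sum_distrib_left mult_ac)
  finally have "Poly_Mapping.lookup (p_poly (Suc j) * L (Suc j) ^ u) a =
      (\<Sum>s\<le>?N. int (?N choose s) *
        Poly_Mapping.lookup (indet (Suc j) ^ s * (p_poly j * L j ^ (?N - s))) a)"
    by (simp only: lookup_sum lookup_of_nat_mult)
  \<comment> \<open>Summands with \<open>s\<close> different from \<open>?t\<close> carry the wrong
    power of the last indeterminate.\<close>
  also have "\<dots> = (\<Sum>s\<le>?N. if s = ?t then int (?N choose s) *
        Poly_Mapping.lookup (p_poly j * L j ^ (?N - s)) (Poly_Mapping.update (Suc j) 0 a) else 0)"
    by (intro sum.cong) (auto simp: lookup_indet_power_mult[OF free])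
  finally show ?thesis
    using le by simp
qed

section \<open>Closed product formula for the coefficients\<close>

text \<open>Induction on \<open>j\<close> with \<open>u\<close> arbitrary: removing the last
  indeterminate replaces \<open>u\<close> by \<open>v = Suc u - t\<close> and contributes a binomial
  coefficient whose factorials telescope. The tail bounds make all differences on the right
  positive, so no subtraction is truncated.\<close>

lemma lookup_p_poly_mult_power:
  assumes "Poly_Mapping.keys a \<subseteq> {1..j}"
    and "(\<Sum>i = 1..j. Poly_Mapping.lookup a i) = j + u"
    and "\<And>k. 1 \<le> k \<Longrightarrow> k < j \<Longrightarrow> (\<Sum>i = k+1..j. Poly_Mapping.lookup a i) \<le> u + j - k"
  shows "Poly_Mapping.lookup (p_poly j * (\<Sum>i = 1..j. indet i) ^ u) a *
      (\<Prod>i = 1..j. fact (Poly_Mapping.lookup a i)) =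
    fact u * (\<Prod>i = 1..j. int (u + j + 1 - i - (\<Sum>k = i+1..j. Poly_Mapping.lookup a k)))"
  using assms
proof (induction j arbitrary: a u)
  case 0
  then have "a = 0" "u = 0" by auto
  then show ?case by (simp add: p_poly_def)
next
  case (Suc j)
  define t where "t = Poly_Mapping.lookup a (Suc j)"
  define b where "b = Poly_Mapping.update (Suc j) 0 a"
  define v where "v = Suc u - t"
  \<comment> \<open>The tail bounds start at \<open>k = 1\<close>, so for \<open>j = 0\<close> the
    total degree supplies the bound.\<close>
  have t: "t \<le> Suc u"
  proof (cases "j = 0")
    case True
    with Suc.prems(2) show ?thesis by (simp add: t_def)
  next
    case False
    with Suc.prems(3)[of j] show ?thesis by (simp add: t_def)
  qed
  have b: "Poly_Mapping.lookup b i = Poly_Mapping.lookup a i" if "i \<le> j" for i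
    using that by (simp add: b_def lookup_update)
  have tail: "(\<Sum>i = k..Suc j. Poly_Mapping.lookup a i) = (\<Sum>i = k..j. Poly_Mapping.lookup b i) + t"
    if "k \<le> Suc j" for k
  proof -
    have "(\<Sum>i = k..j. Poly_Mapping.lookup a i) = (\<Sum>i = k..j. Poly_Mapping.lookup b i)"
      by (intro sum.cong) (auto simp: b)
    with that show ?thesis by (simp add: t_def)
  qed
  have IH: "Poly_Mapping.lookup (p_poly j * (\<Sum>i = 1..j. indet i) ^ v) b *
      (\<Prod>i = 1..j. fact (Poly_Mapping.lookup b i)) =
    fact v * (\<Prod>i = 1..j. int (v + j + 1 - i - (\<Sum>k = i+1..j. Poly_Mapping.lookup b k)))"
  proof (rule Suc.IH)
    show "Poly_Mapping.keys b \<subseteq> {1..j}"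
    proof
      fix i assume "i \<in> Poly_Mapping.keys b"
      then have "i \<in> Poly_Mapping.keys a" "i \<noteq> Suc j"
        by (auto simp: b_def keys_update)
      with Suc.prems(1) have "i \<in> {1..Suc j}" by blast
      with \<open>i \<noteq> Suc j\<close> show "i \<in> {1..j}" by auto
    qed
    show "(\<Sum>i = 1..j. Poly_Mapping.lookup b i) = j + v"
      using Suc.prems(2) tail[of 1] t by (simp add: v_def)
    show "(\<Sum>i = k+1..j. Poly_Mapping.lookup b i) \<le> v + j - k" if "1 \<le> k" "k < j" for k
      using Suc.prems(3)[of k] tail[of "k+1"] t that by (simp add: v_def)
  qed
  have prodb: "(\<Prod>i = 1..j. fact (Poly_Mapping.lookup b i)) =
      (\<Prod>i = 1..j. fact (Poly_Mapping.lookup a i) :: int)"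
    by (intro prod.cong) (auto simp: b)
  \<comment> \<open>Passing from \<open>u + Suc j\<close> to \<open>v + j\<close> subtracts
    \<open>t\<close>, exactly what each tail loses with its last entry.\<close>
  have prodc: "(\<Prod>i = 1..j. int (v + j + 1 - i - (\<Sum>k = i+1..j. Poly_Mapping.lookup b k))) =
      (\<Prod>i = 1..j. int (u + Suc j + 1 - i - (\<Sum>k = i+1..Suc j. Poly_Mapping.lookup a k)))"
  proof (intro prod.cong refl)
    fix i assume "i \<in> {1..j}"
    then show "int (v + j + 1 - i - (\<Sum>k = i+1..j. Poly_Mapping.lookup b k)) =
        int (u + Suc j + 1 - i - (\<Sum>k = i+1..Suc j. Poly_Mapping.lookup a k))"
      using tail[of "i+1"] t by (simp add: v_def)
  qed
  have binom: "int (Suc u choose t) * fact t * fact v = fact (Suc u)"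
    using arg_cong[OF binomial_fact_lemma[OF t], of int] unfolding v_def
    by (simp only: of_nat_mult of_nat_fact mult_ac)
  have rec: "Poly_Mapping.lookup (p_poly (Suc j) * (\<Sum>i = 1..Suc j. indet i) ^ u) a =
      int (Suc u choose t) * Poly_Mapping.lookup (p_poly j * (\<Sum>i = 1..j. indet i) ^ v) b"
    using lookup_p_poly_mult_Suc[of a j u] t unfolding t_def b_def v_def by simp
  let ?Q = "\<Prod>i = 1..j. int (u + Suc j + 1 - i - (\<Sum>k = i+1..Suc j. Poly_Mapping.lookup a k))"
  have "Poly_Mapping.lookup (p_poly (Suc j) * (\<Sum>i = 1..Suc j. indet i) ^ u) a *
      (\<Prod>i = 1..Suc j. fact (Poly_Mapping.lookup a i)) =
    int (Suc u choose t) * fact t *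
      (Poly_Mapping.lookup (p_poly j * (\<Sum>i = 1..j. indet i) ^ v) b *
       (\<Prod>i = 1..j. fact (Poly_Mapping.lookup b i)))"
    unfolding rec prodb by (simp add: t_def mult_ac)
  also have "\<dots> = (int (Suc u choose t) * fact t * fact v) * ?Q"
    unfolding IH prodc by (simp only: mult_ac)
  also have "\<dots> = fact u * (?Q * int (Suc u))"
    unfolding binom by simp
  \<comment> \<open>The factor at \<open>i = Suc j\<close> has an empty tail and equals
    \<open>Suc u\<close>, which was split off from \<open>fact (Suc u)\<close>.\<close>
  also have "?Q * int (Suc u) =
      (\<Prod>i = 1..Suc j. int (u + Suc j + 1 - i - (\<Sum>k = i+1..Suc j. Poly_Mapping.lookup a k)))"
    by simp
  finally show ?case .
qed

text \<open>The instance \<open>u = 0\<close>, moved to the reals so that the factorials can be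
  divided out index by index.\<close>

lemma c_coeff_eq:
  assumes "a \<in> A_set n"
  shows "real_of_int (c_coeff n a) =
    (\<Prod>i = 1..n. real (n + 1 - i - (\<Sum>k = i+1..n. Poly_Mapping.lookup a k)) /
      fact (Poly_Mapping.lookup a i))"
proof -
  have "c_coeff n a * (\<Prod>i = 1..n. fact (Poly_Mapping.lookup a i)) =
      (\<Prod>i = 1..n. int (n + 1 - i - (\<Sum>k = i+1..n. Poly_Mapping.lookup a k)))"
    using lookup_p_poly_mult_power[of a n 0] assms by (auto simp: A_set_def c_coeff_def)
  from arg_cong[OF this, of real_of_int] show ?thesis
    by (simp add: prod_dividef field_simps)
qed

section \<open>Redistributing two neighbouring entries\<close>

lemma A_set_tail:
  assumes "a \<in> A_set n" "i < n"
  shows "(\<Sum>k = i+1..n. Poly_Mapping.lookup a k) \<le> n - i"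
  using assms by (cases "i = 0") (auto simp: A_set_def)

text \<open>The numerator at an index depends only on the later entries. As the sum of the two
  entries is kept, only the numerator at \<open>i\<close> changes: it is \<open>r + 1\<close> minus
  the entry at \<open>i+1\<close>, while \<open>r\<close> is the numerator at \<open>i+1\<close>.
  \<open>K\<close> collects \<open>r\<close> and the factors at all other indices.\<close>

lemma A_set_exchange:
  fixes x y n i :: nat
  assumes a: "a \<in> A_set n" and i: "1 \<le> i" "i < n"
    and xy: "x + y = Poly_Mapping.lookup a i + Poly_Mapping.lookup a (i+1)"
    and x: "x + (\<Sum>k = i+2..n. Poly_Mapping.lookup a k) \<le> n - i"
  defines "b \<equiv> Poly_Mapping.update i y (Poly_Mapping.update (i+1) x a)"
    and "r \<equiv> n - i - (\<Sum>k = i+2..n. Poly_Mapping.lookup a k)"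
  shows "b \<in> A_set n"
    and "\<exists>K > 0.
      real_of_int (c_coeff n a) = K * (real (r + 1 - Poly_Mapping.lookup a (i+1)) /
        (fact (Poly_Mapping.lookup a (i+1)) * fact (Poly_Mapping.lookup a i))) \<and>
      real_of_int (c_coeff n b) = K * (real (r + 1 - x) / (fact x * fact y))"
proof -
  have other: "Poly_Mapping.lookup b k = Poly_Mapping.lookup a k" if "k \<noteq> i" "k \<noteq> i+1" for k
    using that by (simp add: b_def lookup_update)
  have bi: "Poly_Mapping.lookup b i = y" "Poly_Mapping.lookup b (i+1) = x"
    by (simp_all add: b_def lookup_update)
  have high: "(\<Sum>k = l..n. Poly_Mapping.lookup b k) = (\<Sum>k = l..n. Poly_Mapping.lookup a k)"
    if "i + 2 \<le> l" for l
    using that by (intro sum.cong) (auto simp: other)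
  have mid: "(\<Sum>k = i+1..n. Poly_Mapping.lookup c k) =
      Poly_Mapping.lookup c (i+1) + (\<Sum>k = i+2..n. Poly_Mapping.lookup c k)" for c
    using i by (simp add: sum.atLeast_Suc_atMost)
  have low: "(\<Sum>k = l..n. Poly_Mapping.lookup b k) = (\<Sum>k = l..n. Poly_Mapping.lookup a k)"
    if "l \<le> i" for l
  proof -
    have split: "(\<Sum>k = l..n. Poly_Mapping.lookup c k) = (\<Sum>k = l..<i. Poly_Mapping.lookup c k) +
        (Poly_Mapping.lookup c i + (\<Sum>k = i+1..n. Poly_Mapping.lookup c k))" for c
    proof -
      have "{l..n} = {l..<i} \<union> {i..n}" "{l..<i} \<inter> {i..n} = {}" using that i by auto
      then have "(\<Sum>k = l..n. Poly_Mapping.lookup c k) =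
          (\<Sum>k = l..<i. Poly_Mapping.lookup c k) + (\<Sum>k = i..n. Poly_Mapping.lookup c k)"
        by (simp add: sum.union_disjoint)
      then show ?thesis using i by (simp add: sum.atLeast_Suc_atMost)
    qed
    have "(\<Sum>k = l..<i. Poly_Mapping.lookup b k) = (\<Sum>k = l..<i. Poly_Mapping.lookup a k)"
      by (intro sum.cong) (auto simp: other)
    then show ?thesis
      unfolding split mid using xy high[of "i+2"] by (simp add: bi[simplified])
  qed
  show bA: "b \<in> A_set n"
  proof -
    have "Poly_Mapping.keys b \<subseteq> {1..n}"
      using a i by (auto simp: A_set_def b_def keys_update split: if_splits)
    moreover have "(\<Sum>k = l+1..n. Poly_Mapping.lookup b k) \<le> n - l" if "1 \<le> l" "l \<le> n - 1" for l
    proof -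
      \<comment> \<open>Only the tail starting at \<open>i+1\<close> changes, so its bound is the
        one constraint not inherited from \<open>a\<close>.\<close>
      consider "l + 1 \<le> i" | "l = i" | "i + 2 \<le> l + 1" by linarith
      then show ?thesis
      proof cases
        case 2
        then show ?thesis using x mid[of b] high[of "i+2"] bi by simp
      qed (use a that high[of "l+1"] low[of "l+1"] in \<open>auto simp: A_set_def\<close>)
    qed
    moreover have "(\<Sum>k = 1..n. Poly_Mapping.lookup b k) = n"
      using low[of 1] a i by (auto simp: A_set_def)
    ultimately show ?thesis by (auto simp: A_set_def)
  qed
  define T where "T c k = real (n + 1 - k - (\<Sum>l = k+1..n. Poly_Mapping.lookup c l)) /
      fact (Poly_Mapping.lookup c k)" for c k
  have c_T: "real_of_int (c_coeff n c) = (\<Prod>k = 1..n. T c k)" if "c \<in> A_set n" for c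
    using that by (simp only: T_def c_coeff_eq)
  have split: "(\<Prod>k = 1..n. T c k) = (\<Prod>k \<in> {1..n} - {i, i+1}. T c k) * (T c i * T c (i+1))" for c
  proof -
    have "{i, i+1} \<subseteq> {1..n}" using i by auto
    from prod.subset_diff[OF this, of "T c"] show ?thesis by simp
  qed
  have rest: "(\<Prod>k \<in> {1..n} - {i, i+1}. T b k) = (\<Prod>k \<in> {1..n} - {i, i+1}. T a k)"
  proof (intro prod.cong refl)
    fix k assume k: "k \<in> {1..n} - {i, i+1}"
    then have "(\<Sum>l = k+1..n. Poly_Mapping.lookup b l) = (\<Sum>l = k+1..n. Poly_Mapping.lookup a l)"
      using low[of "k+1"] high[of "k+1"] by (cases "k < i") auto
    with k show "T b k = T a k" by (simp add: T_def other)
  qed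
  have pos: "(\<Prod>k \<in> {1..n} - {i, i+1}. T a k) > 0"
  proof (intro prod_pos)
    fix k assume k: "k \<in> {1..n} - {i, i+1}"
    then have "(\<Sum>l = k+1..n. Poly_Mapping.lookup a l) \<le> n - k"
      using A_set_tail[OF a, of k] by (cases "k = n") auto
    with k have "n + 1 - k - (\<Sum>l = k+1..n. Poly_Mapping.lookup a l) > 0" by auto
    then show "T a k > 0"
      unfolding T_def by (intro divide_pos_pos) (simp_all only: of_nat_0_less_iff fact_gt_zero)
  qed
  \<comment> \<open>Besides giving \<open>K > 0\<close>, this rules out truncation in
    \<open>r\<close>, so that the numerator at \<open>i\<close> really has the form
    \<open>r + 1\<close> minus the entry at \<open>i+1\<close>.\<close>
  have r: "r > 0"
    using A_set_tail[OF a, of "i+1"] i by (cases "i + 1 = n") (auto simp: r_def)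
  have Ta: "T c i * T c (i+1) = real r * (real (r + 1 - Poly_Mapping.lookup c (i+1)) /
        (fact (Poly_Mapping.lookup c (i+1)) * fact (Poly_Mapping.lookup c i)))"
    if "(\<Sum>k = i+2..n. Poly_Mapping.lookup c k) = (\<Sum>k = i+2..n. Poly_Mapping.lookup a k)" for c
  proof -
    have "n + 1 - i - (\<Sum>l = i+1..n. Poly_Mapping.lookup c l) = r + 1 - Poly_Mapping.lookup c (i+1)"
      using mid[of c] that i r by (simp add: r_def)
    moreover have "n + 1 - (i+1) - (\<Sum>l = i+1+1..n. Poly_Mapping.lookup c l) = r"
      using that by (simp add: r_def)
    ultimately show ?thesis by (simp only: T_def) (simp add: mult_ac)
  qed
  define K where "K = (\<Prod>k \<in> {1..n} - {i, i+1}. T a k) * real r"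
  have "K > 0" using pos r by (simp add: K_def)
  moreover have "real_of_int (c_coeff n a) = K * (real (r + 1 - Poly_Mapping.lookup a (i+1)) /
        (fact (Poly_Mapping.lookup a (i+1)) * fact (Poly_Mapping.lookup a i)))"
    by (simp only: c_T[OF a] split Ta[OF refl] K_def mult.assoc)
  moreover have "real_of_int (c_coeff n b) = K * (real (r + 1 - x) / (fact x * fact y))"
    by (simp only: c_T[OF bA] split Ta[OF high[OF order_refl]] K_def rest bi mult.assoc)
  ultimately show "\<exists>K > 0.
      real_of_int (c_coeff n a) = K * (real (r + 1 - Poly_Mapping.lookup a (i+1)) /
        (fact (Poly_Mapping.lookup a (i+1)) * fact (Poly_Mapping.lookup a i))) \<and>
      real_of_int (c_coeff n b) = K * (real (r + 1 - x) / (fact x * fact y))"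
    by blast
qed

section \<open>Finiteness and nonemptiness of the index set\<close>

text \<open>Entries sum to \<open>n\<close> and vanish outside \<open>{1..n}\<close>, so
  \<open>lookup\<close> embeds the set into a finite set of functions.\<close>

lemma finite_A_set: "finite (A_set n)"
proof (rule finite_imageD)
  let ?F = "{f. \<forall>x. (x \<in> {1..n} \<longrightarrow> f x \<in> {..n}) \<and> (x \<notin> {1..n} \<longrightarrow> f x = (0::nat))}"
  have "Poly_Mapping.lookup ` A_set n \<subseteq> ?F"
  proof clarify
    fix a x assume a: "a \<in> A_set n"
    have "Poly_Mapping.lookup a x \<le> n" if "x \<in> {1..n}"
      using a member_le_sum[of x "{1..n}" "Poly_Mapping.lookup a"] that by (auto simp: A_set_def)
    moreover have "Poly_Mapping.lookup a x = 0" if "x \<notin> {1..n}"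
      using a that by (auto simp: A_set_def in_keys_iff)
    ultimately show "(x \<in> {1..n} \<longrightarrow> Poly_Mapping.lookup a x \<in> {..n}) \<and>
        (x \<notin> {1..n} \<longrightarrow> Poly_Mapping.lookup a x = 0)" by auto
  qed
  then show "finite (Poly_Mapping.lookup ` A_set n)"
    by (rule finite_subset) (intro finite_set_of_finite_funs finite_atLeastAtMost finite_atMost)
  show "inj_on Poly_Mapping.lookup (A_set n)"
    by (auto intro!: inj_onI poly_mapping_eqI)
qed

lemma A_set_nonempty:
  assumes "n \<ge> 1"
  shows "A_set n \<noteq> {}"
proof -
  \<comment> \<open>The monomial \<open>x_1^n\<close>, all of whose proper tails are zero.\<close>
  have "Poly_Mapping.single 1 n \<in> A_set n"
    using assms by (auto simp: A_set_def lookup_single when_def)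
  then show ?thesis by blast
qed

section \<open>The two improving moves\<close>

text \<open>Swapping the two entries keeps the factorials and raises the single changed numerator
  from \<open>r + 1 - a\<^sub>i\<^sub>+\<^sub>1\<close> to \<open>r + 1 - a\<^sub>i\<close>.\<close>

lemma c_coeff_swap_less:
  fixes n i :: nat
  assumes a: "a \<in> A_set n" and i: "1 \<le> i" "i < n"
    and less: "Poly_Mapping.lookup a i < Poly_Mapping.lookup a (i+1)"
  shows "\<exists>b \<in> A_set n. c_coeff n a < c_coeff n b"
proof -
  define x y where "x = Poly_Mapping.lookup a (i+1)" and "y = Poly_Mapping.lookup a i"
  define r where "r = n - i - (\<Sum>k = i+2..n. Poly_Mapping.lookup a k)"
  have "x + (\<Sum>k = i+2..n. Poly_Mapping.lookup a k) \<le> n - i"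
    using A_set_tail[OF a, of i] i by (simp add: x_def sum.atLeast_Suc_atMost)
  with less have le: "y + (\<Sum>k = i+2..n. Poly_Mapping.lookup a k) \<le> n - i" and "x \<le> r"
    by (auto simp: x_def y_def r_def)
  let ?b = "Poly_Mapping.update i x (Poly_Mapping.update (i+1) y a)"
  have sum: "y + x = Poly_Mapping.lookup a i + Poly_Mapping.lookup a (i+1)"
    by (simp add: x_def y_def)
  obtain K where K: "K > 0" "real_of_int (c_coeff n a) = K * (real (r + 1 - x) / (fact x * fact y))"
    "real_of_int (c_coeff n ?b) = K * (real (r + 1 - y) / (fact y * fact x))"
    using A_set_exchange(2)[OF a i sum le] unfolding x_def y_def r_def by blast
  have "real (r + 1 - x) / (fact x * fact y) < real (r + 1 - y) / (fact x * fact y)"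
    using \<open>x \<le> r\<close> less by (intro divide_strict_right_mono) (auto simp: x_def y_def)
  then have "K * (real (r + 1 - x) / (fact x * fact y)) < K * (real (r + 1 - y) / (fact y * fact x))"
    using K(1) by (simp only: mult_strict_left_mono mult.commute[of "fact y"])
  then have "real_of_int (c_coeff n a) < real_of_int (c_coeff n ?b)"
    by (simp only: K)
  with A_set_exchange(1)[OF a i sum le] show ?thesis by auto
qed

text \<open>One unit moves from \<open>i\<close> to \<open>i+1\<close>. With \<open>x\<close> the
  old entry at \<open>i+1\<close> and \<open>y\<close> the new one at \<open>i\<close>, cancelling
  common factors leaves \<open>(r + 1 - x) * (x + 1) \<le> (r - x) * (y + 1)\<close>, which holds
  because \<open>x + 1 \<le> y\<close> and \<open>x + y \<le> r\<close>.\<close>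

lemma c_coeff_balance_le:
  fixes n i :: nat
  assumes a: "a \<in> A_set n" and i: "1 \<le> i" "i < n"
    and less: "Poly_Mapping.lookup a (i+1) + 1 < Poly_Mapping.lookup a i"
  shows "\<exists>b \<in> A_set n. c_coeff n a \<le> c_coeff n b \<and>
    (\<Sum>k = 1..n. (Poly_Mapping.lookup b k)\<^sup>2) < (\<Sum>k = 1..n. (Poly_Mapping.lookup a k)\<^sup>2)"
proof -
  define x where "x = Poly_Mapping.lookup a (i+1)"
  obtain y where y: "Poly_Mapping.lookup a i = y + 1"
    using less by (cases "Poly_Mapping.lookup a i") auto
  define r where "r = n - i - (\<Sum>k = i+2..n. Poly_Mapping.lookup a k)"
  have xy: "x + 1 \<le> y" using less by (simp add: x_def y)
  \<comment> \<open>The bound on the tail starting at \<open>i\<close>, which is the total sum when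
    \<open>i = 1\<close>. It yields both the admissibility of the move and
    \<open>x + y \<le> r\<close>.\<close>
  have tail: "y + 1 + (x + (\<Sum>k = i+2..n. Poly_Mapping.lookup a k)) \<le> n - i + 1"
  proof -
    have "(\<Sum>k = i..n. Poly_Mapping.lookup a k) \<le> n - (i - 1)"
      using A_set_tail[OF a, of "i-1"] i by simp
    then show ?thesis
      using i by (simp add: x_def y sum.atLeast_Suc_atMost)
  qed
  then have le: "x + 1 + (\<Sum>k = i+2..n. Poly_Mapping.lookup a k) \<le> n - i"
    and r: "x + y \<le> r" using xy by (auto simp: r_def)
  let ?b = "Poly_Mapping.update i y (Poly_Mapping.update (i+1) (x+1) a)"
  have sum: "(x + 1) + y = Poly_Mapping.lookup a i + Poly_Mapping.lookup a (i+1)"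
    by (simp add: x_def y)
  obtain K where K: "K > 0"
    "real_of_int (c_coeff n a) = K * (real (r + 1 - x) / (fact x * fact (y + 1)))"
    "real_of_int (c_coeff n ?b) = K * (real (r + 1 - (x + 1)) / (fact (x + 1) * fact y))"
    using A_set_exchange(2)[OF a i sum le] unfolding x_def y[symmetric] r_def by blast
  \<comment> \<open>The slacks \<open>d\<close> and \<open>e\<close> remove all subtractions and
    leave a polynomial inequality over the naturals.\<close>
  obtain d where d: "r = x + y + d" using r le_Suc_ex by blast
  obtain e where e: "y = x + 1 + e" using xy le_Suc_ex by blast
  have "(r + 1 - x) * (x + 1) \<le> (r - x) * (y + 1)"
    unfolding d e by (simp add: algebra_simps)
  then have "real (r + 1 - x) * real (x + 1) \<le> real (r - x) * real (y + 1)"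
    by (simp only: flip: of_nat_mult of_nat_le_iff[where 'a = real])
  then have "real (r + 1 - x) / (fact x * fact (y + 1)) \<le> real (r - x) / (fact (x + 1) * fact y)"
    by (simp add: divide_simps mult_ac)
  then have "real (r + 1 - x) / (fact x * fact (y + 1)) \<le> real (r + 1 - (x + 1)) / (fact (x + 1) * fact y)"
    by simp
  from mult_left_mono[OF this, of K] have "real_of_int (c_coeff n a) \<le> real_of_int (c_coeff n ?b)"
    using K(1) by (simp only: K less_imp_le)
  then have "c_coeff n a \<le> c_coeff n ?b" by simp
  moreover have "(\<Sum>k = 1..n. (Poly_Mapping.lookup ?b k)\<^sup>2) < (\<Sum>k = 1..n. (Poly_Mapping.lookup a k)\<^sup>2)"
  proof -
    have split: "(\<Sum>k = 1..n. f k) = (\<Sum>k \<in> {1..n} - {i, i+1}. f k) + (f i + f (i+1))"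
      for f :: "nat \<Rightarrow> nat"
    proof -
      have "{i, i+1} \<subseteq> {1..n}" using i by auto
      from sum.subset_diff[OF this, of f] show ?thesis by simp
    qed
    have "(\<Sum>k \<in> {1..n} - {i, i+1}. (Poly_Mapping.lookup ?b k)\<^sup>2) =
        (\<Sum>k \<in> {1..n} - {i, i+1}. (Poly_Mapping.lookup a k)\<^sup>2)"
      by (intro sum.cong) (auto simp: lookup_update)
    \<comment> \<open>The difference of the two sides is \<open>2 * (y - x)\<close>.\<close>
    moreover have "y\<^sup>2 + (x+1)\<^sup>2 < (y+1)\<^sup>2 + x\<^sup>2"
      unfolding e by (simp add: power2_eq_square algebra_simps)
    ultimately show ?thesis
      unfolding split by (simp add: lookup_update x_def y)
  qed
  ultimately show ?thesis
    using A_set_exchange(1)[OF a i sum le] by blast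
qed

section \<open>Choosing a maximiser with least sum of squares\<close>

theorem theorem1:
  fixes n :: nat
  assumes "n \<ge> 1"
  shows "\<exists>a \<in> M_set n. \<forall>b \<in> A_set n. c_coeff n b \<le> c_coeff n a"
proof -
  define X where "X = {a \<in> A_set n. \<forall>b \<in> A_set n. c_coeff n b \<le> c_coeff n a}"
  obtain a0 where "a0 \<in> A_set n" "c_coeff n a0 = Max (c_coeff n ` A_set n)"
    using Max_in[of "c_coeff n ` A_set n"] finite_A_set A_set_nonempty[OF assms] by fastforce
  then have "a0 \<in> X"
    by (auto simp: X_def finite_A_set)
  then obtain a where a: "a \<in> X"
    and least: "\<And>b. b \<in> X \<Longrightarrow>
      (\<Sum>k = 1..n. (Poly_Mapping.lookup a k)\<^sup>2) \<le> (\<Sum>k = 1..n. (Poly_Mapping.lookup b k)\<^sup>2)"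
    using ex_has_least_nat[of "\<lambda>a. a \<in> X" a0 "\<lambda>a. \<Sum>k = 1..n. (Poly_Mapping.lookup a k)\<^sup>2"]
    by blast
  have aA: "a \<in> A_set n" using a by (simp add: X_def)
  have "Poly_Mapping.lookup a (i+1) \<le> Poly_Mapping.lookup a i \<and>
      Poly_Mapping.lookup a i \<le> Poly_Mapping.lookup a (i+1) + 1" if "1 \<le> i" "i \<le> n - 1" for i
  proof -
    have i: "1 \<le> i" "i < n" using that by auto
    \<comment> \<open>Otherwise the swap would produce a coefficient above the maximum.\<close>
    have "\<not> Poly_Mapping.lookup a i < Poly_Mapping.lookup a (i+1)"
      using c_coeff_swap_less[OF aA i] a by (force simp: X_def)
    moreover have "\<not> Poly_Mapping.lookup a (i+1) + 1 < Poly_Mapping.lookup a i"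
    proof
      assume "Poly_Mapping.lookup a (i+1) + 1 < Poly_Mapping.lookup a i"
      from c_coeff_balance_le[OF aA i this] obtain b where b: "b \<in> A_set n"
        "c_coeff n a \<le> c_coeff n b"
        "(\<Sum>k = 1..n. (Poly_Mapping.lookup b k)\<^sup>2) < (\<Sum>k = 1..n. (Poly_Mapping.lookup a k)\<^sup>2)"
        by blast
      \<comment> \<open>Since its coefficient is at least that of the maximiser \<open>a\<close>,
        \<open>b\<close> is a maximiser too, against the minimality of the sum of squares of
        \<open>a\<close>.\<close>
      with a have "b \<in> X" by (force simp: X_def)
      from least[OF this] b(3) show False by simp
    qed
    ultimately show ?thesis by simp
  qed
  with aA have "a \<in> M_set n" by (simp add: M_set_def)
  with a show ?thesis by (auto simp: X_def)
qed

end
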